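(* Let $m\ge 0$ be an integer, let $\Omega_0\subset\mathbb{R}$ be a closed bounded interval and let $u$ be a function on $\Omega_0$. For a closed subinterval $\Omega=[a,b]\subseteq\Omega_0$ of length $h=b-a$ with $0<h\le 1$, let $c_k$ denote the $k$-th Chebyshev coefficient of the re-parametrized function $\tilde u(t)=u\left(\frac{h}{2}t+\frac{a+b}{2}\right)$, $-1\le t\le 1$. Then the following hold. (i) If $u\in X^m(\Omega_0)$, there is a constant $C>0$, independent of $k$ and $h$, such that for every such $\Omega$ and every integer $k\ge 1$, $$|c_k|\le C\,\frac{h^{\min\{k,m+1\}}}{k^{m+2}}.$$ (ii) If $u\in C^{m+2}(\Omega_0)$, there is a constant $C>0$, independent of $k$ and $h$, such that for every such $\Omega$ and every integer $k\ge 1$, $$|c_k|\le C\,\frac{h^{\min\{k,m+2\}}}{k^{m+2}}.$$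
   Context: For a closed bounded interval $I$ and an integer $m\ge 0$, $X^m(I)=C^m(I)\cap C^{m+2}_{\mathrm{pw}}(I)$: the functions that are $m$ times continuously differentiable on $I$ and have piecewise continuous $(m+2)$-th derivative, i.e. there is a finite partition of $I$ such that on each closed subinterval of the partition the function coincides in the interior with a $C^{m+2}$ function on that closed subinterval. $T_k$ is the Chebyshev polynomial of the first kind of degree $k$. The Chebyshev coefficients of a continuous function $\tilde u$ on $[-1,1]$ are $c_k=\frac{\gamma_k}{\pi}\int_{-1}^{1}\tilde u(t)\frac{T_k(t)}{\sqrt{1-t^2}}\,dt$, with $\gamma_0=1$ and $\gamma_k=2$ for $k\ge 1$. *)

theory Defs
  imports "HOL-Analysis.Analysis" "HOL-Computational_Algebra.Polynomial"
begin

(* Derivatives are taken within S, so at the endpoints of a closed interval they are one-sided.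
   Only the values of f on S matter. *)
primrec Ck_on :: "nat \<Rightarrow> real set \<Rightarrow> (real \<Rightarrow> real) \<Rightarrow> bool" where
  "Ck_on 0 S f \<longleftrightarrow> continuous_on S f"
| "Ck_on (Suc n) S f \<longleftrightarrow>
     (\<exists>f'. (\<forall>x\<in>S. (f has_real_derivative f' x) (at x within S)) \<and> Ck_on n S f')"

(* The pieces g i are C^k up to the endpoints of their subinterval; f agrees with them only in the
   open subintervals, so f itself may be discontinuous at the partition points s i. *)
definition Ck_pw_on :: "nat \<Rightarrow> real \<Rightarrow> real \<Rightarrow> (real \<Rightarrow> real) \<Rightarrow> bool" where
  "Ck_pw_on k p q f \<longleftrightarrow>
     (\<exists>(N::nat) (s :: nat \<Rightarrow> real) (g :: nat \<Rightarrow> real \<Rightarrow> real).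
        s 0 = p \<and> s N = q \<and>
        (\<forall>i<N. s i < s (Suc i) \<and> Ck_on k {s i..s (Suc i)} (g i) \<and>
               (\<forall>x\<in>{s i<..<s (Suc i)}. f x = g i x)))"

definition X_space :: "nat \<Rightarrow> real \<Rightarrow> real \<Rightarrow> (real \<Rightarrow> real) set" where
  "X_space m p q = {f. Ck_on m {p..q} f \<and> Ck_pw_on (m + 2) p q f}"

fun cheb_poly :: "nat \<Rightarrow> real poly" where
  "cheb_poly 0 = 1"
| "cheb_poly (Suc 0) = [:0, 1:]"
| "cheb_poly (Suc (Suc n)) = [:0, 2:] * cheb_poly (Suc n) - cheb_poly n"

(* At t = -1 and t = 1 the integrand is 0 by the convention x / 0 = 0, which does not affect
   the integral. *)
definition cheb_coeff :: "(real \<Rightarrow> real) \<Rightarrow> nat \<Rightarrow> real" where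
  "cheb_coeff v k =
     (if k = 0 then 1 else 2) / pi *
       integral {-1..1} (\<lambda>t. v t * (poly (cheb_poly k) t / sqrt (1 - t\<^sup>2)))"

definition reparam :: "(real \<Rightarrow> real) \<Rightarrow> real \<Rightarrow> real \<Rightarrow> real \<Rightarrow> real" where
  "reparam u a b = (\<lambda>t. u ((b - a) / 2 * t + (a + b) / 2))"

end

theory Submission
  imports Defs
begin

text \<open>
  Under \<open>t = cos \<theta>\<close> the \<open>k\<close>-th Chebyshev coefficient of \<open>v\<close> becomes, up to a factor at most \<open>1\<close>
  for \<open>k \<ge> 1\<close>, the cosine integral \<open>J v k\<close>, that is, the integral of \<open>v (cos \<theta>) * cos (k * \<theta>)\<close> over
  \<open>[0, \<pi>]\<close>. Integrating by parts and expanding \<open>sin \<theta> * sin (k * \<theta>)\<close> gives the recurrence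
  \<open>J v k = (J v' (k - 1) - J v' (k + 1)) / (2 * k)\<close> (lemma \<open>cosine_integral_deriv\<close>). For
  \<open>v = reparam u a b\<close> the derivative \<open>v'\<close> is \<open>h / 2\<close> times the reparametrization of \<open>u'\<close>, where
  \<open>h = b - a\<close>. So passing from \<open>u'\<close> to \<open>u\<close> gains one factor \<open>h\<close> and one factor \<open>1 / k\<close>, at the price
  of needing the index \<open>k - 1\<close> for \<open>u'\<close>.

  This price is what produces the exponent \<open>min k n\<close>: a coefficient of index \<open>k\<close> can be
  differentiated only \<open>k\<close> times before the index reaches \<open>0\<close>, where only boundedness is left.
  Accordingly a bound \<open>C * h ^ min k n / (k + 1) ^ r\<close> for \<open>u'\<close>, valid for all \<open>k \<ge> 0\<close>, yields the bound
  with \<open>n + 1\<close> and \<open>r + 1\<close> for \<open>u\<close> (lemma \<open>cheb_decay_antiderivative\<close>), and both parts follow by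
  induction on the order of differentiability. They differ only in where the induction starts:

  \<^item> A continuous function satisfies the bound with \<open>n = r = 0\<close>. Hence \<open>m + 2\<close> steps give part (ii).

  \<^item> A continuous, piecewise \<open>C\<^sup>2\<close> function satisfies it with \<open>n = 1\<close> and \<open>r = 2\<close> (lemma
    \<open>cheb_decay_piecewise_C2\<close>). Hence \<open>m\<close> steps give part (i). Here two integrations by parts on each
    piece are possible. The boundary terms of the first one telescope because the function is
    continuous, while those of the second one, caused by jumps of the derivative, are of order
    \<open>h / k\<^sup>2\<close>, and their number is bounded by the number of pieces on the large interval.
\<close>

section \<open>Chebyshev coefficients as cosine integrals\<close>

definition cosine_integral :: "(real \<Rightarrow> real) \<Rightarrow> nat \<Rightarrow> real" where
  "cosine_integral v k = integral {0..pi} (\<lambda>\<theta>. v (cos \<theta>) * cos (real k * \<theta>))"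

lemma poly_cheb_poly_cos: "poly (cheb_poly k) (cos \<theta>) = cos (real k * \<theta>)"
proof (induction k rule: cheb_poly.induct)
  case (3 n)
  have "cos (real (Suc (Suc n)) * \<theta>) = cos (real (Suc n) * \<theta> + \<theta>)"
    and "cos (real n * \<theta>) = cos (real (Suc n) * \<theta> - \<theta>)"
    by (simp_all add: algebra_simps)
  then show ?case
    using 3 by (simp add: cos_add cos_diff)
qed simp_all

text \<open>
  The substitution is made with \<open>\<theta> = arccos t\<close>, so that the function substituted into is continuous
  on all of \<open>[0, \<pi>]\<close>; the singularity of the Chebyshev weight sits only in the derivative of
  \<open>arccos\<close>, which may fail to exist at the two endpoints.
\<close>

lemma cheb_coeff_eq_cosine_integral:
  assumes v: "continuous_on {-1..1} v"
  shows "cheb_coeff v k = (if k = 0 then 1 else 2) / pi * cosine_integral v k"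
proof -
  let ?f = "\<lambda>\<theta>. v (cos \<theta>) * cos (real k * \<theta>)"
  have f: "continuous_on {0..pi} ?f"
    by (intro continuous_intros continuous_on_compose2[OF v]) auto
  have arccos: "(arccos has_real_derivative inverse (- sqrt (1 - x\<^sup>2))) (at x within {-1..1})"
    if "x \<in> {-1..1} - {-1, 1}" for x
    using that by (intro has_field_derivative_at_within[OF DERIV_arccos]) auto
  have "((\<lambda>x. inverse (- sqrt (1 - x\<^sup>2)) *\<^sub>R ?f (arccos x)) has_integral
          (integral {arccos (-1)..arccos 1} ?f - integral {arccos 1..arccos (-1)} ?f)) {-1..1}"
    by (rule has_integral_substitution_general[where s = "{-1, 1}" and c = 0 and d = pi, OF _ _ _ f])
      (use arccos in \<open>auto intro: continuous_on_arccos' arccos_lbound arccos_ubound\<close>)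
  then have 1: "((\<lambda>x. - (inverse (- sqrt (1 - x\<^sup>2)) *\<^sub>R ?f (arccos x))) has_integral
          cosine_integral v k) {-1..1}"
    by (auto dest: has_integral_neg simp: cosine_integral_def)
  have 2: "- (inverse (- sqrt (1 - x\<^sup>2)) *\<^sub>R ?f (arccos x))
      = v x * (poly (cheb_poly k) x / sqrt (1 - x\<^sup>2))" if "x \<in> {-1..1}" for x
    using poly_cheb_poly_cos[of k "arccos x"] that by (simp add: field_simps)
  have "((\<lambda>x. v x * (poly (cheb_poly k) x / sqrt (1 - x\<^sup>2))) has_integral
      cosine_integral v k) {-1..1}"
    by (rule has_integral_eq[OF 2 1])
  then show ?thesis
    by (simp add: cheb_coeff_def integral_unique)
qed

section \<open>Integration by parts\<close>

lemma integral_cos_by_parts: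
  fixes F D :: "real \<Rightarrow> real"
  assumes "\<alpha> \<le> \<beta>" and k: "k \<noteq> 0"
    and F: "continuous_on {\<alpha>..\<beta>} F" and D: "continuous_on {\<alpha>..\<beta>} D"
    and deriv: "\<And>x. x \<in> {\<alpha><..<\<beta>} \<Longrightarrow> (F has_real_derivative D x) (at x)"
  shows "integral {\<alpha>..\<beta>} (\<lambda>x. F x * cos (k * x))
    = (F \<beta> * sin (k * \<beta>) - F \<alpha> * sin (k * \<alpha>)) / k
      - integral {\<alpha>..\<beta>} (\<lambda>x. D x * sin (k * x)) / k"
proof -
  let ?G = "\<lambda>x. F x * (sin (k * x) / k)"
  have "((\<lambda>x. D x * (sin (k * x) / k) + F x * cos (k * x)) has_integral ?G \<beta> - ?G \<alpha>) {\<alpha>..\<beta>}"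
  proof (rule fundamental_theorem_of_calculus_interior[OF \<open>\<alpha> \<le> \<beta>\<close>])
    show "(?G has_vector_derivative D x * (sin (k * x) / k) + F x * cos (k * x)) (at x)"
      if "x \<in> {\<alpha><..<\<beta>}" for x
      unfolding has_real_derivative_iff_has_vector_derivative[symmetric]
      by (rule derivative_eq_intros deriv[OF that] refl | simp add: k)+
  qed (auto intro!: continuous_intros F simp: k)
  moreover have "((\<lambda>x. D x * sin (k * x)) has_integral
      integral {\<alpha>..\<beta>} (\<lambda>x. D x * sin (k * x))) {\<alpha>..\<beta>}"
    by (intro integrable_integral integrable_continuous_real continuous_intros D)
  then have "((\<lambda>x. D x * sin (k * x) / k) has_integral
      integral {\<alpha>..\<beta>} (\<lambda>x. D x * sin (k * x)) / k) {\<alpha>..\<beta>}"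
    by (rule has_integral_divide)
  ultimately have "((\<lambda>x. D x * (sin (k * x) / k) + F x * cos (k * x) - D x * sin (k * x) / k)
      has_integral ?G \<beta> - ?G \<alpha> - integral {\<alpha>..\<beta>} (\<lambda>x. D x * sin (k * x)) / k) {\<alpha>..\<beta>}"
    by (rule has_integral_diff)
  then show ?thesis
    by (simp add: integral_unique diff_divide_distrib)
qed

lemma integral_sin_by_parts:
  fixes F D :: "real \<Rightarrow> real"
  assumes "\<alpha> \<le> \<beta>" and k: "k \<noteq> 0"
    and F: "continuous_on {\<alpha>..\<beta>} F" and D: "continuous_on {\<alpha>..\<beta>} D"
    and deriv: "\<And>x. x \<in> {\<alpha><..<\<beta>} \<Longrightarrow> (F has_real_derivative D x) (at x)"
  shows "integral {\<alpha>..\<beta>} (\<lambda>x. F x * sin (k * x))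
    = (F \<alpha> * cos (k * \<alpha>) - F \<beta> * cos (k * \<beta>)) / k
      + integral {\<alpha>..\<beta>} (\<lambda>x. D x * cos (k * x)) / k"
proof -
  let ?G = "\<lambda>x. F x * (- cos (k * x) / k)"
  have "((\<lambda>x. D x * (- cos (k * x) / k) + F x * sin (k * x)) has_integral ?G \<beta> - ?G \<alpha>) {\<alpha>..\<beta>}"
  proof (rule fundamental_theorem_of_calculus_interior[OF \<open>\<alpha> \<le> \<beta>\<close>])
    show "(?G has_vector_derivative D x * (- cos (k * x) / k) + F x * sin (k * x)) (at x)"
      if "x \<in> {\<alpha><..<\<beta>}" for x
      unfolding has_real_derivative_iff_has_vector_derivative[symmetric]
      by (rule derivative_eq_intros deriv[OF that] refl | simp add: k)+
  qed (auto intro!: continuous_intros F simp: k)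
  moreover have "((\<lambda>x. D x * cos (k * x)) has_integral
      integral {\<alpha>..\<beta>} (\<lambda>x. D x * cos (k * x))) {\<alpha>..\<beta>}"
    by (intro integrable_integral integrable_continuous_real continuous_intros D)
  then have "((\<lambda>x. D x * cos (k * x) / k) has_integral
      integral {\<alpha>..\<beta>} (\<lambda>x. D x * cos (k * x)) / k) {\<alpha>..\<beta>}"
    by (rule has_integral_divide)
  ultimately have "((\<lambda>x. D x * (- cos (k * x) / k) + F x * sin (k * x) + D x * cos (k * x) / k)
      has_integral ?G \<beta> - ?G \<alpha> + integral {\<alpha>..\<beta>} (\<lambda>x. D x * cos (k * x)) / k) {\<alpha>..\<beta>}"
    by (rule has_integral_add)
  then show ?thesis
    by (simp add: integral_unique diff_divide_distrib)
qed

section \<open>Cosine integrals of functions and of their derivatives\<close>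

lemma cosine_integral_abs_le:
  assumes v: "continuous_on {-1..1} v" and M: "\<And>t. t \<in> {-1..1} \<Longrightarrow> \<bar>v t\<bar> \<le> M"
  shows "\<bar>cosine_integral v k\<bar> \<le> M * pi"
proof -
  have "\<bar>v (cos \<theta>) * cos (real k * \<theta>)\<bar> \<le> M * 1" for \<theta>
    unfolding abs_mult by (intro mult_mono M) (auto intro: order_trans[OF abs_ge_zero M[of 0]])
  then have "norm (integral {0..pi} (\<lambda>\<theta>. v (cos \<theta>) * cos (real k * \<theta>))) \<le> M * (pi - 0)"
    by (intro integral_bound continuous_intros continuous_on_compose2[OF v]) auto
  then show ?thesis
    by (simp add: cosine_integral_def)
qed

text \<open>
  The boundary terms vanish because \<open>sin (k * \<theta>)\<close> is zero at \<open>0\<close> and \<open>\<pi>\<close>, and the factor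
  \<open>sin \<theta>\<close> from the chain rule turns \<open>sin (k * \<theta>)\<close> into a difference of two cosines.
\<close>

lemma cosine_integral_deriv:
  assumes v: "continuous_on {-1..1} v" and v': "continuous_on {-1..1} v'"
    and deriv: "\<And>t. t \<in> {-1<..<1} \<Longrightarrow> (v has_real_derivative v' t) (at t)"
    and "1 \<le> k"
  shows "cosine_integral v k
    = (cosine_integral v' (k - 1) - cosine_integral v' (k + 1)) / (2 * real k)"
proof -
  let ?D = "\<lambda>\<theta>. v' (cos \<theta>) * - sin \<theta>"
  have cos_interior: "cos \<theta> \<in> {-1<..<1}" if "\<theta> \<in> {0<..<pi}" for \<theta> :: real
    using cos_monotone_0_pi[of 0 \<theta>] cos_monotone_0_pi[of \<theta> pi] that by auto
  have int: "(\<lambda>\<theta>. v' (cos \<theta>) * cos (real j * \<theta>)) integrable_on {0..pi}" for j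
    by (intro integrable_continuous_real continuous_intros continuous_on_compose2[OF v']) auto
  have D: "((\<lambda>\<theta>. v (cos \<theta>)) has_real_derivative ?D \<theta>) (at \<theta>)" if "\<theta> \<in> {0<..<pi}" for \<theta>
    by (rule DERIV_chain2[OF deriv[OF cos_interior[OF that]] DERIV_cos])
  have "cosine_integral v k = - integral {0..pi} (\<lambda>\<theta>. ?D \<theta> * sin (real k * \<theta>)) / real k"
    unfolding cosine_integral_def
    by (subst integral_cos_by_parts[where D = ?D])
      (use \<open>1 \<le> k\<close> D in \<open>auto intro!: continuous_intros continuous_on_compose2[OF v]
        continuous_on_compose2[OF v']\<close>)
  also have "integral {0..pi} (\<lambda>\<theta>. ?D \<theta> * sin (real k * \<theta>))
    = integral {0..pi} (\<lambda>\<theta>. (v' (cos \<theta>) * cos (real (k + 1) * \<theta>)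
        - v' (cos \<theta>) * cos (real (k - 1) * \<theta>)) / 2)"
  proof (rule integral_cong)
    fix \<theta>
    have "real (k + 1) * \<theta> = real k * \<theta> + \<theta>" "real (k - 1) * \<theta> = real k * \<theta> - \<theta>"
      using \<open>1 \<le> k\<close> by (simp_all add: algebra_simps of_nat_diff)
    then show "?D \<theta> * sin (real k * \<theta>) = (v' (cos \<theta>) * cos (real (k + 1) * \<theta>)
        - v' (cos \<theta>) * cos (real (k - 1) * \<theta>)) / 2"
      by (simp only: cos_add cos_diff) (simp add: algebra_simps)
  qed
  also have "\<dots> = (cosine_integral v' (k + 1) - cosine_integral v' (k - 1)) / 2"
    by (simp only: integral_divide integral_diff[OF int int] cosine_integral_def)
  finally show ?thesis
    by (simp only: minus_divide_left minus_diff_eq divide_divide_eq_left)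
qed

section \<open>Piecewise smooth functions\<close>

text \<open>
  The boundary terms \<open>v * sin (k * \<theta>) / k\<close> of the first integration by parts are only of order
  \<open>1 / k\<close>. They are therefore kept on the left-hand side, to cancel between neighbouring pieces;
  everything that is left after the second integration by parts is of order \<open>1 / k\<^sup>2\<close>. The
  derivatives are required only in the open interval, so that corners at \<open>y\<close> and \<open>z\<close> are possible.
\<close>

lemma cosine_integral_piece:
  assumes "- 1 \<le> y" "y \<le> z" "z \<le> 1" and "1 \<le> k"
    and v: "continuous_on {y..z} v"
    and v1: "continuous_on {y..z} v1" and v2: "continuous_on {y..z} v2"
    and deriv1: "\<And>t. t \<in> {y<..<z} \<Longrightarrow> (v has_real_derivative v1 t) (at t)"
    and deriv2: "\<And>t. t \<in> {y<..<z} \<Longrightarrow> (v1 has_real_derivative v2 t) (at t)"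
    and M1: "\<And>t. t \<in> {y..z} \<Longrightarrow> \<bar>v1 t\<bar> \<le> M" and M2: "\<And>t. t \<in> {y..z} \<Longrightarrow> \<bar>v2 t\<bar> \<le> M"
  shows "\<bar>integral {arccos z..arccos y} (\<lambda>\<theta>. v (cos \<theta>) * cos (real k * \<theta>))
      - (v y * sin (real k * arccos y) - v z * sin (real k * arccos z)) / real k\<bar>
    \<le> (2 + 2 * pi) * M / (real k)\<^sup>2"
proof -
  define \<alpha> where "\<alpha> = arccos z"
  define \<beta> where "\<beta> = arccos y"
  have ab: "0 \<le> \<alpha>" "\<alpha> \<le> \<beta>" "\<beta> \<le> pi" "cos \<alpha> = z" "cos \<beta> = y"
    using assms(1-3) by (auto simp: \<alpha>_def \<beta>_def arccos_le_mono arccos_lbound arccos_ubound)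
  have cos_piece: "cos \<theta> \<in> {y..z}" if "\<theta> \<in> {\<alpha>..\<beta>}" for \<theta>
    using cos_monotone_0_pi_le[of \<alpha> \<theta>] cos_monotone_0_pi_le[of \<theta> \<beta>] that ab by auto
  have cos_interior: "cos \<theta> \<in> {y<..<z}" if "\<theta> \<in> {\<alpha><..<\<beta>}" for \<theta>
    using cos_monotone_0_pi[of \<alpha> \<theta>] cos_monotone_0_pi[of \<theta> \<beta>] that ab by auto
  have "0 \<le> M"
    using M1[of y] \<open>y \<le> z\<close> by force
  let ?D = "\<lambda>\<theta>. v1 (cos \<theta>) * - sin \<theta>"
  let ?E = "\<lambda>\<theta>. v2 (cos \<theta>) * (sin \<theta>)\<^sup>2 - v1 (cos \<theta>) * cos \<theta>"
  have contD: "continuous_on {\<alpha>..\<beta>} ?D" and contE: "continuous_on {\<alpha>..\<beta>} ?E"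
    using cos_piece
    by (auto intro!: continuous_intros continuous_on_compose2[OF v1] continuous_on_compose2[OF v2])
  have D: "((\<lambda>\<theta>. v (cos \<theta>)) has_real_derivative ?D \<theta>) (at \<theta>)" if "\<theta> \<in> {\<alpha><..<\<beta>}" for \<theta>
    by (rule DERIV_chain2[OF deriv1[OF cos_interior[OF that]] DERIV_cos])
  have E: "(?D has_real_derivative ?E \<theta>) (at \<theta>)" if "\<theta> \<in> {\<alpha><..<\<beta>}" for \<theta>
  proof -
    have "((\<lambda>\<theta>. v1 (cos \<theta>)) has_real_derivative v2 (cos \<theta>) * - sin \<theta>) (at \<theta>)"
      by (rule DERIV_chain2[OF deriv2[OF cos_interior[OF that]] DERIV_cos])
    then show ?thesis
      by (auto intro!: derivative_eq_intros simp: power2_eq_square algebra_simps)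
  qed
  have boundD: "\<bar>?D \<theta> * cos (real k * \<theta>)\<bar> \<le> M" if "\<theta> \<in> {\<alpha>..\<beta>}" for \<theta>
  proof -
    have "\<bar>?D \<theta> * cos (real k * \<theta>)\<bar> \<le> (M * 1) * 1"
      unfolding abs_mult abs_minus_cancel
      using M1[OF cos_piece[OF that]] \<open>0 \<le> M\<close> by (intro mult_mono) auto
    then show ?thesis by simp
  qed
  have boundE: "norm (?E \<theta> * cos (real k * \<theta>)) \<le> 2 * M" if "\<theta> \<in> {\<alpha>..\<beta>}" for \<theta>
  proof -
    have "\<bar>v2 (cos \<theta>) * (sin \<theta>)\<^sup>2\<bar> \<le> M * 1" "\<bar>v1 (cos \<theta>) * cos \<theta>\<bar> \<le> M * 1"
      unfolding abs_mult using M1[OF cos_piece[OF that]] M2[OF cos_piece[OF that]] \<open>0 \<le> M\<close>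
      by (auto intro!: mult_mono simp del: mult_1_right simp: abs_square_le_1)
    then have "\<bar>?E \<theta>\<bar> * \<bar>cos (real k * \<theta>)\<bar> \<le> (2 * M) * 1"
      by (intro mult_mono) (use \<open>0 \<le> M\<close> in auto)
    then show ?thesis by (simp add: abs_mult)
  qed
  define IE where "IE = integral {\<alpha>..\<beta>} (\<lambda>\<theta>. ?E \<theta> * cos (real k * \<theta>))"
  have "norm IE \<le> 2 * M * (\<beta> - \<alpha>)"
    unfolding IE_def
    by (rule integral_bound) (use ab boundE in \<open>auto intro!: continuous_intros contE\<close>)
  also have "\<dots> \<le> 2 * M * pi"
    using ab \<open>0 \<le> M\<close> by (intro mult_left_mono) auto
  finally have IE: "\<bar>IE\<bar> \<le> 2 * M * pi" by simp
  have "continuous_on {\<alpha>..\<beta>} (\<lambda>\<theta>. v (cos \<theta>))"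
    using cos_piece by (auto intro!: continuous_intros continuous_on_compose2[OF v])
  then have "integral {\<alpha>..\<beta>} (\<lambda>\<theta>. v (cos \<theta>) * cos (real k * \<theta>))
      = (v y * sin (real k * \<beta>) - v z * sin (real k * \<alpha>)) / real k
        - integral {\<alpha>..\<beta>} (\<lambda>\<theta>. ?D \<theta> * sin (real k * \<theta>)) / real k"
    using integral_cos_by_parts[of \<alpha> \<beta> "real k" "\<lambda>\<theta>. v (cos \<theta>)" ?D] ab \<open>1 \<le> k\<close> D contD
    by simp
  also have "integral {\<alpha>..\<beta>} (\<lambda>\<theta>. ?D \<theta> * sin (real k * \<theta>))
      = (?D \<alpha> * cos (real k * \<alpha>) - ?D \<beta> * cos (real k * \<beta>)) / real k + IE / real k"
    unfolding IE_def
    using integral_sin_by_parts[of \<alpha> \<beta> "real k" ?D ?E] ab \<open>1 \<le> k\<close> E contD contE by simp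
  finally have "\<bar>integral {\<alpha>..\<beta>} (\<lambda>\<theta>. v (cos \<theta>) * cos (real k * \<theta>))
      - (v y * sin (real k * \<beta>) - v z * sin (real k * \<alpha>)) / real k\<bar>
    = \<bar>?D \<alpha> * cos (real k * \<alpha>) - ?D \<beta> * cos (real k * \<beta>) + IE\<bar> / (real k)\<^sup>2"
    by (simp add: power2_eq_square add_divide_distrib[symmetric] abs_divide)
  also have "\<dots> \<le> (2 + 2 * pi) * M / (real k)\<^sup>2"
    using boundD[of \<alpha>] boundD[of \<beta>] ab IE by (intro divide_right_mono) (auto simp: algebra_simps)
  finally show ?thesis
    unfolding \<alpha>_def \<beta>_def .
qed

text \<open>
  The breakpoints need only be weakly increasing: when a partition of a large interval is cut down to
  a smaller one, the breakpoints outside collapse to the endpoints, and the hypotheses on a piece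
  are asked for only if it has positive length.
\<close>

lemma cosine_integral_piecewise_C2:
  fixes y :: "nat \<Rightarrow> real"
  assumes v: "continuous_on {-1..1} v" and "1 \<le> k"
    and y: "y 0 = -1" "y N = 1" "\<And>i. i < N \<Longrightarrow> y i \<le> y (Suc i)" "\<And>i. i \<le> N \<Longrightarrow> y i \<in> {-1..1}"
    and v1: "\<And>i. i < N \<Longrightarrow> y i < y (Suc i) \<Longrightarrow> continuous_on {y i..y (Suc i)} (v1 i)"
    and v2: "\<And>i. i < N \<Longrightarrow> y i < y (Suc i) \<Longrightarrow> continuous_on {y i..y (Suc i)} (v2 i)"
    and deriv1: "\<And>i t. i < N \<Longrightarrow> t \<in> {y i<..<y (Suc i)} \<Longrightarrow> (v has_real_derivative v1 i t) (at t)"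
    and deriv2: "\<And>i t. i < N \<Longrightarrow> t \<in> {y i<..<y (Suc i)} \<Longrightarrow> (v1 i has_real_derivative v2 i t) (at t)"
    and "0 \<le> M"
    and M1: "\<And>i t. i < N \<Longrightarrow> y i < y (Suc i) \<Longrightarrow> t \<in> {y i..y (Suc i)} \<Longrightarrow> \<bar>v1 i t\<bar> \<le> M"
    and M2: "\<And>i t. i < N \<Longrightarrow> y i < y (Suc i) \<Longrightarrow> t \<in> {y i..y (Suc i)} \<Longrightarrow> \<bar>v2 i t\<bar> \<le> M"
  shows "\<bar>cosine_integral v k\<bar> \<le> real N * ((2 + 2 * pi) * M / (real k)\<^sup>2)"
proof -
  let ?f = "\<lambda>\<theta>. v (cos \<theta>) * cos (real k * \<theta>)"
  define K where "K = (2 + 2 * pi) * M / (real k)\<^sup>2"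
  have f: "?f integrable_on {\<alpha>..\<beta>}" for \<alpha> \<beta>
    by (intro integrable_continuous_real continuous_intros continuous_on_compose2[OF v]) auto
  \<comment> \<open>The sum over the first \<open>n\<close> pieces: \<open>arccos\<close> reverses the order, so they cover the angles from
    \<open>arccos (y n)\<close> to \<open>\<pi>\<close>, and of the telescoping boundary terms only the one at \<open>y n\<close> survives.\<close>
  have "\<bar>integral {arccos (y n)..pi} ?f + v (y n) * sin (real k * arccos (y n)) / real k\<bar>
      \<le> real n * K" if "n \<le> N" for n
    using that
  proof (induction n)
    case 0
    then show ?case by (simp add: y)
  next
    case (Suc n)
    then have range: "y n \<in> {-1..1}" "y (Suc n) \<in> {-1..1}" "y n \<le> y (Suc n)"
      using y by auto
    have "\<bar>integral {arccos (y (Suc n))..arccos (y n)} ?f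
        - (v (y n) * sin (real k * arccos (y n))
          - v (y (Suc n)) * sin (real k * arccos (y (Suc n)))) / real k\<bar> \<le> K"
    proof (cases "y n = y (Suc n)")
      case True
      then show ?thesis
        using \<open>0 \<le> M\<close> by (simp add: K_def)
    next
      case False
      then show ?thesis
        unfolding K_def
        by (intro cosine_integral_piece[where ?v1.0 = "v1 n" and ?v2.0 = "v2 n"])
          (use range Suc.prems \<open>1 \<le> k\<close> v1 v2 deriv1 deriv2 M1 M2
            in \<open>auto intro: continuous_on_subset[OF v]\<close>)
    qed
    moreover have "integral {arccos (y (Suc n))..arccos (y n)} ?f + integral {arccos (y n)..pi} ?f
        = integral {arccos (y (Suc n))..pi} ?f"
      using range by (intro Henstock_Kurzweil_Integration.integral_combine f)
        (auto simp: arccos_le_mono arccos_ubound)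
    moreover have "real (Suc n) * K = real n * K + K"
      by (simp add: distrib_right)
    ultimately show ?case
      using Suc.IH Suc.prems unfolding diff_divide_distrib by linarith
  qed
  from this[of N] show ?thesis
    by (simp add: y cosine_integral_def K_def)
qed

section \<open>Decay uniformly over subintervals\<close>

text \<open>
  The index \<open>k = 0\<close> is included, since the recurrence for \<open>k = 1\<close> refers to it; the denominator
  \<open>(k + 1) ^ r\<close> instead of \<open>k ^ r\<close> makes the bound meaningful there.
\<close>

definition cheb_decay :: "real \<Rightarrow> real \<Rightarrow> nat \<Rightarrow> nat \<Rightarrow> (real \<Rightarrow> real) \<Rightarrow> bool" where
  "cheb_decay p q n r u \<longleftrightarrow>
     (\<exists>C>0. \<forall>a b k. {a..b} \<subseteq> {p..q} \<and> 0 < b - a \<and> b - a \<le> 1 \<longrightarrow>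
        \<bar>cosine_integral (reparam u a b) k\<bar> \<le> C * (b - a) ^ min k n / (real k + 1) ^ r)"

lemma affine_mem_interval:
  fixes a b t :: real
  assumes "a \<le> b" "t \<in> {-1..1}"
  shows "(b - a) / 2 * t + (a + b) / 2 \<in> {a..b}"
proof -
  have "0 \<le> (b - a) * (1 - t)" "0 \<le> (b - a) * (1 + t)"
    using assms by auto
  then show ?thesis by (simp add: field_simps)
qed

lemma affine_mem_interior:
  fixes a b t :: real
  assumes "a < b" "t \<in> {-1<..<1}"
  shows "(b - a) / 2 * t + (a + b) / 2 \<in> {a<..<b}"
proof -
  have "0 < (b - a) * (1 - t)" "0 < (b - a) * (1 + t)"
    using assms by auto
  then show ?thesis by (simp add: field_simps)
qed

lemma continuous_on_reparam:
  assumes "continuous_on {p..q} u" "{a..b} \<subseteq> {p..q}" "a \<le> b"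
  shows "continuous_on {-1..1} (reparam u a b)"
  unfolding reparam_def
proof (rule continuous_on_compose2[OF assms(1)])
  show "(\<lambda>t. (b - a) / 2 * t + (a + b) / 2) ` {-1..1} \<subseteq> {p..q}"
    using affine_mem_interval[OF assms(3)] assms(2) by blast
qed (intro continuous_intros)

lemma reparam_has_derivative:
  assumes "(u has_real_derivative d) (at ((b - a) / 2 * t + (a + b) / 2))"
  shows "(reparam u a b has_real_derivative (b - a) / 2 * d) (at t)"
proof -
  have "((\<lambda>t. (b - a) / 2 * t + (a + b) / 2) has_real_derivative (b - a) / 2) (at t)"
    by (auto intro!: derivative_eq_intros)
  from DERIV_chain2[OF assms this] show ?thesis
    unfolding reparam_def by (simp add: mult.commute)
qed

lemma deriv_within_imp_at:
  assumes "(f has_real_derivative d) (at x within {p..q})" "p < x" "x < q"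
  shows "(f has_real_derivative d) (at x)"
  using assms at_within_interior[of x "{p..q}"] by simp

lemma cosine_integral_scale: "cosine_integral (\<lambda>t. c * v t) k = c * cosine_integral v k"
  by (simp add: cosine_integral_def mult.assoc)

lemma continuous_on_bounded:
  fixes f :: "real \<Rightarrow> real"
  assumes "continuous_on {p..q} f"
  obtains M where "0 < M" "\<And>x. x \<in> {p..q} \<Longrightarrow> \<bar>f x\<bar> \<le> M"
proof -
  have "bounded (f ` {p..q})"
    by (rule compact_imp_bounded[OF compact_continuous_image[OF assms compact_Icc]])
  then obtain M where "0 < M" "\<forall>y\<in>f ` {p..q}. norm y \<le> M"
    unfolding bounded_pos by blast
  then show ?thesis
    by (intro that[of M]) auto
qed

lemma cheb_bounded_of_continuous:
  assumes u: "continuous_on {p..q} u"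
  obtains C where "0 < C"
    "\<And>a b k. {a..b} \<subseteq> {p..q} \<Longrightarrow> a < b \<Longrightarrow> \<bar>cosine_integral (reparam u a b) k\<bar> \<le> C"
proof -
  obtain M where M: "0 < M" "\<And>x. x \<in> {p..q} \<Longrightarrow> \<bar>u x\<bar> \<le> M"
    using continuous_on_bounded[OF u] by blast
  have "\<bar>cosine_integral (reparam u a b) k\<bar> \<le> M * pi" if ab: "{a..b} \<subseteq> {p..q}" "a < b" for a b k
  proof (rule cosine_integral_abs_le)
    show "continuous_on {-1..1} (reparam u a b)"
      using continuous_on_reparam[OF u] ab by simp
    show "\<bar>reparam u a b t\<bar> \<le> M" if "t \<in> {-1..1}" for t
      unfolding reparam_def using affine_mem_interval[of a b t] that ab by (intro M) auto
  qed
  then show ?thesis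
    using that[of "M * pi"] M by simp
qed

lemma cheb_decay_continuous:
  assumes "continuous_on {p..q} u"
  shows "cheb_decay p q 0 0 u"
proof -
  obtain C where "0 < C"
    "\<And>a b k. {a..b} \<subseteq> {p..q} \<Longrightarrow> a < b \<Longrightarrow> \<bar>cosine_integral (reparam u a b) k\<bar> \<le> C"
    using cheb_bounded_of_continuous[OF assms] by blast
  then show ?thesis
    unfolding cheb_decay_def by (auto intro!: exI[of _ C])
qed

text \<open>
  For \<open>k \<ge> 1\<close> the recurrence raises the exponent of \<open>h\<close> from \<open>min (k - 1) n\<close> to
  \<open>min (k - 1) n + 1 = min k (n + 1)\<close>; the term with index \<open>k + 1\<close> is no worse because \<open>h \<le> 1\<close>.
  For \<open>k = 0\<close> the recurrence is void, but the bound asserts only boundedness.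
\<close>

lemma cheb_decay_antiderivative:
  assumes u': "continuous_on {p..q} u'"
    and deriv: "\<And>x. x \<in> {p..q} \<Longrightarrow> (u has_real_derivative u' x) (at x within {p..q})"
    and decay: "cheb_decay p q n r u'"
  shows "cheb_decay p q (Suc n) (Suc r) u"
proof -
  have u: "continuous_on {p..q} u"
    using deriv by (rule DERIV_continuous_on)
  obtain C where C: "0 < C" "\<And>a b k. {a..b} \<subseteq> {p..q} \<Longrightarrow> 0 < b - a \<Longrightarrow> b - a \<le> 1 \<Longrightarrow>
      \<bar>cosine_integral (reparam u' a b) k\<bar> \<le> C * (b - a) ^ min k n / (real k + 1) ^ r"
    using decay unfolding cheb_decay_def by blast
  obtain C0 where C0: "0 < C0"
    "\<And>a b k. {a..b} \<subseteq> {p..q} \<Longrightarrow> a < b \<Longrightarrow> \<bar>cosine_integral (reparam u a b) k\<bar> \<le> C0"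
    using cheb_bounded_of_continuous[OF u] by blast
  have "\<bar>cosine_integral (reparam u a b) k\<bar>
      \<le> (C0 + 2 ^ Suc r * C) * (b - a) ^ min k (Suc n) / (real k + 1) ^ Suc r"
    if ab: "{a..b} \<subseteq> {p..q}" "0 < b - a" "b - a \<le> 1" for a b k
  proof (cases "k = 0")
    case True
    then show ?thesis
      using C0(2)[of a b 0] ab C(1) by (simp add: add_increasing2)
  next
    case False
    define h where "h = b - a"
    have h: "0 < h" "h \<le> 1" using ab by (auto simp: h_def)
    have k: "1 \<le> k" "1 \<le> real k" using False by auto
    let ?V = "cosine_integral (reparam u' a b)"
    \<comment> \<open>The induction hypothesis at index \<open>k - 1\<close>; it also bounds the term of index \<open>k + 1\<close>.\<close>
    let ?X = "C * h ^ min (k - 1) n / real k ^ r"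
    have pq: "p \<le> a" "b \<le> q" using ab by auto
    have "cosine_integral (reparam u a b) k
        = (cosine_integral (\<lambda>t. h / 2 * reparam u' a b t) (k - 1)
          - cosine_integral (\<lambda>t. h / 2 * reparam u' a b t) (k + 1)) / (2 * real k)"
    proof (rule cosine_integral_deriv[OF _ _ _ k(1)])
      show "(reparam u a b has_real_derivative h / 2 * reparam u' a b t) (at t)"
        if t: "t \<in> {-1<..<1}" for t
      proof -
        have "(b - a) / 2 * t + (a + b) / 2 \<in> {a<..<b}"
          using affine_mem_interior[OF _ t, of a b] ab by simp
        then have "(u has_real_derivative u' ((b - a) / 2 * t + (a + b) / 2))
            (at ((b - a) / 2 * t + (a + b) / 2))"
          using pq by (intro deriv_within_imp_at[OF deriv]) auto
        from reparam_has_derivative[OF this] show ?thesis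
          by (simp add: reparam_def h_def)
      qed
    qed (use ab in \<open>auto intro!: continuous_intros continuous_on_reparam[OF u] continuous_on_reparam[OF u']\<close>)
    then have "\<bar>cosine_integral (reparam u a b) k\<bar> = h * \<bar>?V (k - 1) - ?V (k + 1)\<bar> / (4 * real k)"
      using h k unfolding cosine_integral_scale right_diff_distrib[symmetric]
      by (simp add: abs_mult)
    also have "\<dots> \<le> h * (2 * ?X) / (4 * real k)"
    proof -
      have 1: "\<bar>?V (k - 1)\<bar> \<le> ?X"
        using C(2)[OF ab, of "k - 1"] k by (simp add: h_def of_nat_diff)
      have "\<bar>?V (k + 1)\<bar> \<le> C * h ^ min (k + 1) n / (real (k + 1) + 1) ^ r"
        using C(2)[OF ab, of "k + 1"] by (simp only: h_def)
      also have "\<dots> \<le> ?X"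
        using h k C(1)
        by (intro frac_le mult_left_mono power_mono power_decreasing) auto
      finally have "\<bar>?V (k - 1) - ?V (k + 1)\<bar> \<le> 2 * ?X"
        using 1 by linarith
      then show ?thesis
        using h k by (intro divide_right_mono mult_left_mono) auto
    qed
    also have "\<dots> = (C / 2) * h ^ min k (Suc n) / real k ^ Suc r"
    proof -
      have "min k (Suc n) = Suc (min (k - 1) n)" using k by auto
      then show ?thesis using k by (simp add: field_simps)
    qed
    \<comment> \<open>Since \<open>k \<ge> 1\<close>, \<open>k\<close> is at least \<open>(k + 1) / 2\<close>; this is where \<open>2 ^ Suc r\<close> comes from.\<close>
    also have "\<dots> \<le> (C / 2) * h ^ min k (Suc n) / ((real k + 1) / 2) ^ Suc r"
      using h k C(1) by (intro divide_left_mono power_mono) auto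
    also have "\<dots> = 2 ^ r * C * h ^ min k (Suc n) / (real k + 1) ^ Suc r"
      by (simp add: power_divide)
    also have "\<dots> \<le> (C0 + 2 ^ Suc r * C) * h ^ min k (Suc n) / (real k + 1) ^ Suc r"
      using h C(1) C0(1) by (intro divide_right_mono mult_right_mono) auto
    finally show ?thesis unfolding h_def .
  qed
  then show ?thesis
    unfolding cheb_decay_def using C(1) C0(1)
    by (intro exI[of _ "C0 + 2 ^ Suc r * C"]) (auto intro: add_pos_pos)
qed

lemma Ck_on_imp_continuous_on: "Ck_on n S f \<Longrightarrow> continuous_on S f"
  by (cases n) (auto intro: DERIV_continuous_on)

section \<open>The two smoothness classes\<close>

lemma cheb_decay_Ck:
  "Ck_on n {p..q} u \<Longrightarrow> cheb_decay p q n n u"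
proof (induction n arbitrary: u)
  case 0
  then show ?case by (simp add: cheb_decay_continuous)
next
  case (Suc n)
  then show ?case
    by (auto intro: cheb_decay_antiderivative Ck_on_imp_continuous_on)
qed

lemma has_derivative_of_piece:
  fixes f g :: "real \<Rightarrow> real"
  assumes "(g has_real_derivative d) (at x within {s..t})" "x \<in> {s<..<t}"
    and "\<And>y. y \<in> {s<..<t} \<Longrightarrow> f y = g y"
  shows "(f has_real_derivative d) (at x)"
proof (rule has_field_derivative_transform_within_open)
  show "(g has_real_derivative d) (at x)"
    using deriv_within_imp_at[OF assms(1)] assms(2) by simp
  show "open {s<..<t}" by simp
qed (use assms in auto)

lemma finite_common_bound:
  fixes P :: "nat \<Rightarrow> real \<Rightarrow> bool"
  assumes "\<And>i. i < N \<Longrightarrow> \<exists>M>0. P i M" and mono: "\<And>i M M'. P i M \<Longrightarrow> M \<le> M' \<Longrightarrow> P i M'"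
  shows "\<exists>M>0. \<forall>i<N. P i M"
  using assms(1)
proof (induction N)
  case 0
  show ?case by (auto intro: exI[of _ 1])
next
  case (Suc N)
  then obtain M M' where "0 < M" "\<forall>i<N. P i M" "0 < M'" "P N M'"
    by (metis less_Suc_eq)
  then show ?case
    by (intro exI[of _ "max M M'"]) (auto simp: less_Suc_eq intro: mono)
qed

text \<open>
  The pieces on \<open>[p, q]\<close> provide one bound for the first two derivatives, so all constants are
  independent of the subinterval. The partition is pulled back to \<open>[-1, 1]\<close> by the inverse of
  the affine map \<open>t \<mapsto> A * t + c\<close> and clipped. Each derivative contributes a factor
  \<open>A = (b - a) / 2 \<le> 1\<close>; a single one is kept as the factor \<open>b - a\<close> of the estimate, because the first
  derivative, with its jumps, has no more.
\<close>

lemma cheb_decay_piecewise_C2: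
  assumes u: "continuous_on {p..q} u" and pw: "Ck_pw_on 2 p q u"
  shows "cheb_decay p q 1 2 u"
proof -
  obtain N s g where s: "s 0 = p" "s N = q" "\<And>i. i < N \<Longrightarrow> s i < s (Suc i)"
    and g: "\<And>i. i < N \<Longrightarrow> Ck_on 2 {s i..s (Suc i)} (g i)"
    and ug: "\<And>i x. i < N \<Longrightarrow> x \<in> {s i<..<s (Suc i)} \<Longrightarrow> u x = g i x"
    using pw unfolding Ck_pw_on_def by (metis (no_types, lifting))
  have "\<forall>i. \<exists>d1 d2. i < N \<longrightarrow>
      (\<forall>x\<in>{s i..s (Suc i)}. (g i has_real_derivative d1 x) (at x within {s i..s (Suc i)})) \<and>
      (\<forall>x\<in>{s i..s (Suc i)}. (d1 has_real_derivative d2 x) (at x within {s i..s (Suc i)})) \<and>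
      continuous_on {s i..s (Suc i)} d2"
    using g by (simp add: numeral_2_eq_2)
  then obtain d1 d2 where
    d1: "\<And>i x. i < N \<Longrightarrow> x \<in> {s i..s (Suc i)} \<Longrightarrow>
        (g i has_real_derivative d1 i x) (at x within {s i..s (Suc i)})"
    and d2: "\<And>i x. i < N \<Longrightarrow> x \<in> {s i..s (Suc i)} \<Longrightarrow>
        (d1 i has_real_derivative d2 i x) (at x within {s i..s (Suc i)})"
    and cont2: "\<And>i. i < N \<Longrightarrow> continuous_on {s i..s (Suc i)} (d2 i)"
    by metis
  have cont1: "continuous_on {s i..s (Suc i)} (d1 i)" if "i < N" for i
    using d2[OF that] by (rule DERIV_continuous_on)
  have "\<exists>M>0. \<forall>i<N. \<forall>x\<in>{s i..s (Suc i)}. \<bar>d1 i x\<bar> \<le> M \<and> \<bar>d2 i x\<bar> \<le> M"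
  proof (rule finite_common_bound)
    fix i assume "i < N"
    obtain M1 M2 where "0 < M1" "\<And>x. x \<in> {s i..s (Suc i)} \<Longrightarrow> \<bar>d1 i x\<bar> \<le> M1"
      "0 < M2" "\<And>x. x \<in> {s i..s (Suc i)} \<Longrightarrow> \<bar>d2 i x\<bar> \<le> M2"
      using continuous_on_bounded[OF cont1[OF \<open>i < N\<close>]] continuous_on_bounded[OF cont2[OF \<open>i < N\<close>]]
      by metis
    then show "\<exists>M>0. \<forall>x\<in>{s i..s (Suc i)}. \<bar>d1 i x\<bar> \<le> M \<and> \<bar>d2 i x\<bar> \<le> M"
      by (intro exI[of _ "M1 + M2"]) fastforce
  qed fastforce
  then obtain M where M: "0 < M"
    "\<And>i x. i < N \<Longrightarrow> x \<in> {s i..s (Suc i)} \<Longrightarrow> \<bar>d1 i x\<bar> \<le> M"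
    "\<And>i x. i < N \<Longrightarrow> x \<in> {s i..s (Suc i)} \<Longrightarrow> \<bar>d2 i x\<bar> \<le> M"
    by metis
  obtain C0 where C0: "0 < C0"
    "\<And>a b k. {a..b} \<subseteq> {p..q} \<Longrightarrow> a < b \<Longrightarrow> \<bar>cosine_integral (reparam u a b) k\<bar> \<le> C0"
    using cheb_bounded_of_continuous[OF u] by blast
  \<comment> \<open>\<open>C0\<close> serves \<open>k = 0\<close>; for \<open>k \<ge> 1\<close> the factor \<open>4\<close> accounts for \<open>1 / k\<^sup>2 \<le> 4 / (k + 1)\<^sup>2\<close>.\<close>
  define C where "C = C0 + 4 * (real N * ((2 + 2 * pi) * M))"
  have "0 < C"
    using C0(1) M(1) by (auto simp: C_def intro!: add_pos_nonneg mult_nonneg_nonneg)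
  have "\<bar>cosine_integral (reparam u a b) k\<bar> \<le> C * (b - a) ^ min k 1 / (real k + 1) ^ 2"
    if ab: "{a..b} \<subseteq> {p..q}" "0 < b - a" "b - a \<le> 1" for a b k
  proof (cases "k = 0")
    case True
    have "C0 \<le> C" unfolding C_def using M(1) by simp
    with True show ?thesis
      using C0(2)[of a b 0] ab by simp
  next
    case False
    then have k: "1 \<le> k" "1 \<le> real k" by auto
    have pq: "p \<le> a" "b \<le> q" using ab by auto
    define A where "A = (b - a) / 2"
    have A: "0 < A" "A \<le> 1" using ab by (auto simp: A_def)
    define c where "c = (a + b) / 2"
    have R: "reparam w a b t = w (A * t + c)" for w t
      by (simp add: reparam_def A_def c_def)
    define y where "y i = max (-1) (min 1 ((s i - c) / A))" for i
    have y_mono: "y i \<le> y (Suc i)" if "i < N" for i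
      using s(3)[OF that] A unfolding y_def by (intro max.mono min.mono divide_right_mono) auto
    have interior: "A * t + c \<in> {s i<..<s (Suc i)}" if "t \<in> {y i<..<y (Suc i)}" for i t
    proof -
      have "(s i - c) / A < t" "t < (s (Suc i) - c) / A"
        using that by (auto simp: y_def)
      then show ?thesis using A by (simp add: field_simps)
    qed
    have closed: "A * t + c \<in> {s i..s (Suc i)}"
      if "y i < y (Suc i)" "t \<in> {y i..y (Suc i)}" for i t
    proof -
      have "(s i - c) / A \<le> t" "t \<le> (s (Suc i) - c) / A"
        using that by (auto simp: y_def)
      then show ?thesis using A by (simp add: field_simps)
    qed
    have "\<bar>cosine_integral (reparam u a b) k\<bar> \<le> real N * ((2 + 2 * pi) * (A * M) / (real k)\<^sup>2)"
    proof (rule cosine_integral_piecewise_C2[where y = y and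
          ?v1.0 = "\<lambda>i t. A * d1 i (A * t + c)" and ?v2.0 = "\<lambda>i t. A * (A * d2 i (A * t + c))"])
      show "continuous_on {-1..1} (reparam u a b)"
        using continuous_on_reparam[OF u] ab by simp
      show "y 0 = -1" "y N = 1"
        using pq A s(1,2) by (auto simp: y_def A_def c_def field_simps)
      show "y i \<in> {-1..1}" for i
        by (auto simp: y_def)
    next
      fix i assume i: "i < N" "y i < y (Suc i)"
      show "continuous_on {y i..y (Suc i)} (\<lambda>t. A * d1 i (A * t + c))"
        using closed[OF i(2)]
        by (intro continuous_intros continuous_on_compose2[OF cont1[OF i(1)]]) auto
      show "continuous_on {y i..y (Suc i)} (\<lambda>t. A * (A * d2 i (A * t + c)))"
        using closed[OF i(2)]
        by (intro continuous_intros continuous_on_compose2[OF cont2[OF i(1)]]) auto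
      fix t assume t: "t \<in> {y i..y (Suc i)}"
      show "\<bar>A * d1 i (A * t + c)\<bar> \<le> A * M"
        using M(2)[OF i(1) closed[OF i(2) t]] A by (simp add: abs_mult)
      have "A * \<bar>d2 i (A * t + c)\<bar> \<le> 1 * M"
        using M(3)[OF i(1) closed[OF i(2) t]] A by (intro mult_mono) auto
      then show "\<bar>A * (A * d2 i (A * t + c))\<bar> \<le> A * M"
        using A by (simp add: abs_mult)
    next
      fix i t assume i: "i < N" and t: "t \<in> {y i<..<y (Suc i)}"
      note st = interior[OF t]
      have u_deriv: "(u has_real_derivative d1 i (A * t + c)) (at (A * t + c))"
        using st by (intro has_derivative_of_piece[OF d1[OF i] _ ug[OF i]]) auto
      have d1_deriv: "(d1 i has_real_derivative d2 i (A * t + c)) (at (A * t + c))"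
        using st by (intro has_derivative_of_piece[OF d2[OF i] _ refl]) auto
      show "(reparam u a b has_real_derivative A * d1 i (A * t + c)) (at t)"
        using reparam_has_derivative[of u _ b a t] u_deriv by (simp add: A_def c_def)
      have "((\<lambda>t. d1 i (A * t + c)) has_real_derivative A * d2 i (A * t + c)) (at t)"
        using reparam_has_derivative[of "d1 i" _ b a t] d1_deriv
        by (simp add: R[abs_def] flip: A_def c_def)
      then show "((\<lambda>t. A * d1 i (A * t + c)) has_real_derivative A * (A * d2 i (A * t + c))) (at t)"
        by (rule DERIV_cmult)
    qed (use k y_mono A M(1) in auto)
    also have "\<dots> \<le> real N * ((2 + 2 * pi) * ((b - a) * M) / ((real k + 1) / 2)\<^sup>2)"
      using A k M(1) ab by (intro mult_left_mono frac_le power_mono mult_right_mono) (auto simp: A_def)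
    also have "\<dots> = 4 * (real N * ((2 + 2 * pi) * M)) * (b - a) / (real k + 1)\<^sup>2"
      by (simp add: power_divide)
    also have "\<dots> \<le> C * (b - a) / (real k + 1)\<^sup>2"
      using C0(1) ab by (intro divide_right_mono mult_right_mono) (auto simp: C_def)
    finally show ?thesis
      using k by simp
  qed
  then show ?thesis
    unfolding cheb_decay_def using \<open>0 < C\<close> by blast
qed

text \<open>
  The derivatives of the pieces are pieces of \<open>u'\<close>, since \<open>u\<close> coincides with a piece on an open
  interval and derivatives at interior points are unique.
\<close>

lemma X_space_SucE:
  assumes "u \<in> X_space (Suc m) p q"
  obtains u' where "\<And>x. x \<in> {p..q} \<Longrightarrow> (u has_real_derivative u' x) (at x within {p..q})"
    and "u' \<in> X_space m p q"
proof -
  obtain u' where u': "\<And>x. x \<in> {p..q} \<Longrightarrow> (u has_real_derivative u' x) (at x within {p..q})"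
    and Ck: "Ck_on m {p..q} u'"
    using assms unfolding X_space_def mem_Collect_eq Ck_on.simps by blast
  obtain N s g where s: "s 0 = p" "s N = q" "\<And>i. i < N \<Longrightarrow> s i < s (Suc i)"
    and g: "\<And>i. i < N \<Longrightarrow> Ck_on (Suc (m + 2)) {s i..s (Suc i)} (g i)"
    and ug: "\<And>i x. i < N \<Longrightarrow> x \<in> {s i<..<s (Suc i)} \<Longrightarrow> u x = g i x"
    using assms unfolding X_space_def Ck_pw_on_def mem_Collect_eq add_Suc
    by (metis (no_types, lifting))
  have "\<forall>i. \<exists>d. i < N \<longrightarrow>
      (\<forall>x\<in>{s i..s (Suc i)}. (g i has_real_derivative d x) (at x within {s i..s (Suc i)})) \<and>
      Ck_on (m + 2) {s i..s (Suc i)} d"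
    using g unfolding Ck_on.simps by blast
  then obtain d where
    d: "\<And>i x. i < N \<Longrightarrow> x \<in> {s i..s (Suc i)} \<Longrightarrow>
        (g i has_real_derivative d i x) (at x within {s i..s (Suc i)})"
    and Ckd: "\<And>i. i < N \<Longrightarrow> Ck_on (m + 2) {s i..s (Suc i)} (d i)"
    by metis
  have s_mono: "s i \<le> s j" if "i \<le> j" "j \<le> N" for i j
    using that
  proof (induction rule: dec_induct)
    case (step j)
    then show ?case using s(3)[of j] by simp
  qed simp
  have "u' x = d i x" if i: "i < N" and x: "x \<in> {s i<..<s (Suc i)}" for i x
  proof (rule DERIV_unique)
    show "(u has_real_derivative d i x) (at x)"
      using x by (intro has_derivative_of_piece[OF d[OF i] x ug[OF i]]) auto
    show "(u has_real_derivative u' x) (at x)"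
      using x i s(1,2) s_mono[of 0 i] s_mono[of "Suc i" N]
      by (intro deriv_within_imp_at[OF u']) auto
  qed
  then have "Ck_pw_on (m + 2) p q u'"
    unfolding Ck_pw_on_def using s Ckd by blast
  with Ck have "u' \<in> X_space m p q"
    by (simp add: X_space_def)
  with u' show ?thesis
    by (rule that)
qed

lemma cheb_decay_X_space:
  "u \<in> X_space m p q \<Longrightarrow> cheb_decay p q (m + 1) (m + 2) u"
proof (induction m arbitrary: u)
  case 0
  then show ?case
    using cheb_decay_piecewise_C2[of p q u] by (simp add: X_space_def numeral_2_eq_2)
next
  case (Suc m)
  from Suc.prems obtain u'
    where "\<And>x. x \<in> {p..q} \<Longrightarrow> (u has_real_derivative u' x) (at x within {p..q})"
      and "u' \<in> X_space m p q"
    using X_space_SucE by blast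
  then show ?case
    using cheb_decay_antiderivative[of p q u' u "m + 1" "m + 2"] Suc.IH
    by (auto simp: X_space_def intro: Ck_on_imp_continuous_on)
qed

lemma cheb_decay_imp_cheb_coeff_bound:
  assumes u: "continuous_on {p..q} u" and decay: "cheb_decay p q n r u"
  shows "\<exists>C>0. \<forall>a b k. {a..b} \<subseteq> {p..q} \<and> 0 < b - a \<and> b - a \<le> 1 \<and> 1 \<le> k \<longrightarrow>
    \<bar>cheb_coeff (reparam u a b) k\<bar> \<le> C * (b - a) ^ min k n / real k ^ r"
proof -
  obtain C where C: "0 < C" "\<And>a b k. {a..b} \<subseteq> {p..q} \<Longrightarrow> 0 < b - a \<Longrightarrow> b - a \<le> 1 \<Longrightarrow>
      \<bar>cosine_integral (reparam u a b) k\<bar> \<le> C * (b - a) ^ min k n / (real k + 1) ^ r"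
    using decay unfolding cheb_decay_def by blast
  have "\<bar>cheb_coeff (reparam u a b) k\<bar> \<le> C * (b - a) ^ min k n / real k ^ r"
    if ab: "{a..b} \<subseteq> {p..q}" "0 < b - a" "b - a \<le> 1" and "1 \<le> k" for a b k
  proof -
    have "\<bar>cheb_coeff (reparam u a b) k\<bar> = 2 / pi * \<bar>cosine_integral (reparam u a b) k\<bar>"
      using cheb_coeff_eq_cosine_integral[OF continuous_on_reparam[OF u], of a b k] ab \<open>1 \<le> k\<close>
      by (simp add: abs_mult)
    also have "\<dots> \<le> 1 * \<bar>cosine_integral (reparam u a b) k\<bar>"
      using pi_ge_two by (intro mult_right_mono) auto
    also have "\<dots> \<le> C * (b - a) ^ min k n / (real k + 1) ^ r"
      using C(2)[OF ab] by simp
    also have "\<dots> \<le> C * (b - a) ^ min k n / real k ^ r"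
      using C(1) ab \<open>1 \<le> k\<close> by (intro divide_left_mono power_mono) auto
    finally show ?thesis .
  qed
  then show ?thesis
    using C(1) by blast
qed

theorem theorem3p5:
  fixes m :: nat and p q :: real and u :: "real \<Rightarrow> real"
  assumes "p \<le> q"
  shows "(u \<in> X_space m p q \<longrightarrow>
            (\<exists>C>0. \<forall>a b k. {a..b} \<subseteq> {p..q} \<and> 0 < b - a \<and> b - a \<le> 1 \<and> 1 \<le> k \<longrightarrow>
               \<bar>cheb_coeff (reparam u a b) k\<bar> \<le> C * (b - a) ^ min k (m + 1) / real k ^ (m + 2)))
       \<and> (Ck_on (m + 2) {p..q} u \<longrightarrow>
            (\<exists>C>0. \<forall>a b k. {a..b} \<subseteq> {p..q} \<and> 0 < b - a \<and> b - a \<le> 1 \<and> 1 \<le> k \<longrightarrow>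
               \<bar>cheb_coeff (reparam u a b) k\<bar> \<le> C * (b - a) ^ min k (m + 2) / real k ^ (m + 2)))"
proof (intro conjI impI)
  assume "u \<in> X_space m p q"
  then show "\<exists>C>0. \<forall>a b k. {a..b} \<subseteq> {p..q} \<and> 0 < b - a \<and> b - a \<le> 1 \<and> 1 \<le> k \<longrightarrow>
      \<bar>cheb_coeff (reparam u a b) k\<bar> \<le> C * (b - a) ^ min k (m + 1) / real k ^ (m + 2)"
    by (intro cheb_decay_imp_cheb_coeff_bound cheb_decay_X_space)
      (auto simp: X_space_def intro: Ck_on_imp_continuous_on)
next
  assume "Ck_on (m + 2) {p..q} u"
  then show "\<exists>C>0. \<forall>a b k. {a..b} \<subseteq> {p..q} \<and> 0 < b - a \<and> b - a \<le> 1 \<and> 1 \<le> k \<longrightarrow>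
      \<bar>cheb_coeff (reparam u a b) k\<bar> \<le> C * (b - a) ^ min k (m + 2) / real k ^ (m + 2)"
    by (intro cheb_decay_imp_cheb_coeff_bound cheb_decay_Ck Ck_on_imp_continuous_on)
qed

end
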